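(* Under the setting of the context, let $f_1,\dots,f_K\in\mathcal C(\mathcal Y)$ be congruent, i.e. $\sum_{k=1}^K\lambda_k f_k\equiv 0$ on $\mathcal Y$. Then $$\mathcal L^*-\mathcal L(f_1,\dots,f_K)=\epsilon\sum_{k=1}^K\lambda_k\,\mathrm{KL}(\pi_k^*\,\|\,\pi^{f_k})\;\ge\;\epsilon\sum_{k=1}^K\lambda_k\,\mathrm{KL}(\mathbb Q^*\,\|\,\mathbb Q^{f_k}).$$
   Context: Let $K\ge 1$. For $k=1,\dots,K$ let $\mathcal X_k\subset\mathbb R^{D_k}$ be compact, and let $\mathcal Y\subset\mathbb R^{D}$ be compact with positive Lebesgue measure. Let $\mathbb P_k$ be an absolutely continuous Borel probability measure on $\mathcal X_k$. Let $c_k:\mathcal X_k\times\mathcal Y\to\mathbb R$ be continuous. Fix weights $\lambda_k>0$ with $\sum_k\lambda_k=1$ and fix $\epsilon>0$. For $\mu\in\mathcal P(\mathcal Y)$, the differential entropy is $H(\mu)=-\int\log\frac{d\mu}{dy}\,d\mu$ if $\mu$ is absolutely continuous, and $-\infty$ otherwise. Define $$\mathrm{EOT}_{c,\epsilon}(\mathbb P,\mathbb Q)=\min_{\pi\in\Pi(\mathbb P,\mathbb Q)}\Big\{\int c\,d\pi-\epsilon\int H(\pi(\cdot\mid x))\,d\mathbb P(x)\Big\},$$ where $\Pi(\mathbb P,\mathbb Q)$ is the set of couplings and $\pi(\cdot\mid x)$ is the conditional of $\pi$ given the first coordinate. The barycenter value is $$\mathcal L^*=\inf_{\mathbb Q\in\mathcal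 P(\mathcal Y)}\sum_k\lambda_k\,\mathrm{EOT}_{c_k,\epsilon}(\mathbb P_k,\mathbb Q).$$ Assume this is finite for some $\mathbb Q$. Then the infimum is attained at a unique $\mathbb Q^*$, the barycenter. $\pi_k^*\in\Pi(\mathbb P_k,\mathbb Q^* )$ denotes the (unique) minimizer in $\mathrm{EOT}_{c_k,\epsilon}(\mathbb P_k,\mathbb Q^* )$. For $f\in\mathcal C(\mathcal Y)$, the weak entropic $c_k$-transform is $$f^{C_k}(x)=\inf_{\mu\in\mathcal P(\mathcal Y)}\Big\{\int c_k(x,y)\,d\mu-\epsilon H(\mu)-\int f\,d\mu\Big\}=-\epsilon\log Z_{c_k}(f,x),$$ where $Z_{c_k}(f,x)=\int_{\mathcal Y}\exp\big((f(y)-c_k(x,y))/\epsilon\big)\,dy$. Further definitions: - $\mathcal L(f_1,\dots,f_K)=\sum_k\lambda_k\int f_k^{C_k}\,d\mathbb P_k$. - $\mu^{f}_{x}$ is the probability measure on $\mathcal Y$ with density $Z_{c_k}(f,x)^{-1}\exp\big((f(y)-c_k(x,y))/\epsilon\big)$. - $\pi^{f_k}$ is the probability measure on $\mathcal X_k\times\mathcal Y$ given by $d\pi^{f_k}(x,y)=d\mu^{f_k}_x(y)\,d\mathbb P_k(x)$. - $\mathbb Q^{f_k}$ is the second marginal of $\pi^{f_k}$. - $\mathrm{KL}$ denotes the Kullback–Leibler divergence. *)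

theory Defs
  imports "HOL-Probability.Probability"
begin

definition lebR :: "nat \<Rightarrow> (nat \<Rightarrow> real) measure" where
  "lebR n = PiM {..<n} (\<lambda>_. lborel)"

definition ereal_integral :: "'a measure \<Rightarrow> ('a \<Rightarrow> ereal) \<Rightarrow> ereal" where
  "ereal_integral M g =
     enn2ereal (\<integral>\<^sup>+ x. e2ennreal (g x) \<partial>M) - enn2ereal (\<integral>\<^sup>+ x. e2ennreal (- g x) \<partial>M)"

definition diff_entropy :: "'y::euclidean_space measure \<Rightarrow> ereal" where
  "diff_entropy \<mu> =
     (if sets \<mu> = sets lborel \<and> absolutely_continuous lborel \<mu>
      then ereal_integral \<mu> (\<lambda>y. ereal (- ln (enn2real (RN_deriv lborel \<mu> y))))
      else -\<infinity>)"

definition KL :: "'a measure \<Rightarrow> 'a measure \<Rightarrow> ereal" where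
  "KL \<mu> \<nu> =
     (if sets \<mu> = sets \<nu> \<and> absolutely_continuous \<nu> \<mu>
      then ereal_integral \<mu> (\<lambda>x. ereal (ln (enn2real (RN_deriv \<nu> \<mu> x))))
      else \<infinity>)"

definition probs_on :: "'y::euclidean_space set \<Rightarrow> 'y measure set" where
  "probs_on Y = {Q. prob_space Q \<and> sets Q = sets lborel \<and> emeasure Q Y = 1}"

definition coupling :: "'x measure \<Rightarrow> 'y::euclidean_space measure \<Rightarrow> ('x \<times> 'y) measure \<Rightarrow> bool" where
  "coupling P Q \<pi> \<longleftrightarrow>
     sets \<pi> = sets (P \<Otimes>\<^sub>M lborel) \<and> distr \<pi> P fst = P \<and> distr \<pi> lborel snd = Q"

definition cond_kernel :: "'x measure \<Rightarrow> ('x \<times> 'y::euclidean_space) measure \<Rightarrow> ('x \<Rightarrow> 'y measure) \<Rightarrow> bool" where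
  "cond_kernel P \<pi> \<kappa> \<longleftrightarrow>
     \<kappa> \<in> P \<rightarrow>\<^sub>M prob_algebra lborel \<and>
     (\<forall>A \<in> sets (P \<Otimes>\<^sub>M lborel). emeasure \<pi> A = (\<integral>\<^sup>+ x. emeasure (\<kappa> x) (Pair x -` A) \<partial>P))"

text \<open>EOT objective: int c d pi - eps int H(pi(.|x)) dP(x); the cost is integrated over S = X x Y,
  on which every coupling is concentrated.\<close>
definition EOT_obj :: "('x \<times> 'y::euclidean_space \<Rightarrow> real) \<Rightarrow> ('x \<times> 'y) set \<Rightarrow> real \<Rightarrow>
    'x measure \<Rightarrow> ('x \<times> 'y) measure \<Rightarrow> ('x \<Rightarrow> 'y measure) \<Rightarrow> ereal" where
  "EOT_obj c S \<epsilon> P \<pi> \<kappa> =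
     ereal (LINT z:S|\<pi>. c z) - ereal \<epsilon> * ereal_integral P (\<lambda>x. diff_entropy (\<kappa> x))"

definition EOT :: "('x \<times> 'y::euclidean_space \<Rightarrow> real) \<Rightarrow> ('x \<times> 'y) set \<Rightarrow> real \<Rightarrow>
    'x measure \<Rightarrow> 'y measure \<Rightarrow> ereal" where
  "EOT c S \<epsilon> P Q =
     (INF p \<in> {(\<pi>, \<kappa>). coupling P Q \<pi> \<and> cond_kernel P \<pi> \<kappa>}. EOT_obj c S \<epsilon> P (fst p) (snd p))"

definition EOT_minimizer :: "('x \<times> 'y::euclidean_space \<Rightarrow> real) \<Rightarrow> ('x \<times> 'y) set \<Rightarrow> real \<Rightarrow>
    'x measure \<Rightarrow> 'y measure \<Rightarrow> ('x \<times> 'y) measure \<Rightarrow> bool" where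
  "EOT_minimizer c S \<epsilon> P Q \<pi> \<longleftrightarrow>
     coupling P Q \<pi> \<and> (\<exists>\<kappa>. cond_kernel P \<pi> \<kappa> \<and> EOT_obj c S \<epsilon> P \<pi> \<kappa> = EOT c S \<epsilon> P Q)"

definition Zc :: "('x \<times> 'y::euclidean_space \<Rightarrow> real) \<Rightarrow> 'y set \<Rightarrow> real \<Rightarrow> ('y \<Rightarrow> real) \<Rightarrow> 'x \<Rightarrow> real" where
  "Zc c Y \<epsilon> f x = (LINT y:Y|lborel. exp ((f y - c (x, y)) / \<epsilon>))"

definition ctrans :: "('x \<times> 'y::euclidean_space \<Rightarrow> real) \<Rightarrow> 'y set \<Rightarrow> real \<Rightarrow> ('y \<Rightarrow> real) \<Rightarrow> 'x \<Rightarrow> real" where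
  "ctrans c Y \<epsilon> f x = - \<epsilon> * ln (Zc c Y \<epsilon> f x)"

text \<open>pi^f: d pi^f(x,y) = d mu^f_x(y) dP(x), mu^f_x having Lebesgue density
  Z^{-1} exp((f y - c(x,y))/eps) on Y.\<close>
definition pi_f :: "('x \<times> 'y::euclidean_space \<Rightarrow> real) \<Rightarrow> 'y set \<Rightarrow> real \<Rightarrow> 'x measure \<Rightarrow> ('y \<Rightarrow> real) \<Rightarrow> ('x \<times> 'y) measure" where
  "pi_f c Y \<epsilon> P f = density (P \<Otimes>\<^sub>M lborel)
     (\<lambda>(x, y). ennreal (indicator Y y * exp ((f y - c (x, y)) / \<epsilon>) / Zc c Y \<epsilon> f x))"

definition Q_f :: "('x \<times> 'y::euclidean_space \<Rightarrow> real) \<Rightarrow> 'y set \<Rightarrow> real \<Rightarrow> 'x measure \<Rightarrow> ('y \<Rightarrow> real) \<Rightarrow> 'y measure" where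
  "Q_f c Y \<epsilon> P f = distr (pi_f c Y \<epsilon> P f) lborel snd"

end

theory Submission
  imports Defs
begin

text \<open>
  For a plan \<open>\<pi>\<close> with marginals \<open>P\<close>, \<open>Q\<close> and conditional kernel \<open>\<kappa>\<close>, taking logarithms in the
  explicit density of \<open>\<pi>\<^sup>f\<close> and integrating against \<open>\<pi>\<close> yields
  \<open>\<epsilon> KL(\<pi> | \<pi>\<^sup>f) = (\<integral>c d\<pi> - \<epsilon> \<integral>H(\<kappa> x) dP) - \<integral>f dQ - \<integral>f\<^sup>C dP\<close> whenever the objective is finite.
  Averaging over \<open>k\<close> with \<open>Q = Q\<^sup>*\<close>, congruence removes the terms \<open>\<integral>f\<^sub>k dQ\<^sup>*\<close>.
  The inequality is the data processing inequality for the projection onto the second coordinate,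
  which integrates \<open>ln q \<le> ln r + q / r - 1\<close> for the densities \<open>r\<close> of the plans and \<open>q\<close> of their
  marginals.
\<close>

section \<open>Extended-real integrals, divergence and entropy in terms of densities\<close>

lemma ereal_integral_cong_AE:
  assumes "AE x in M. g x = h x"
  shows "ereal_integral M g = ereal_integral M h"
proof -
  have "(\<integral>\<^sup>+ x. e2ennreal (g x) \<partial>M) = (\<integral>\<^sup>+ x. e2ennreal (h x) \<partial>M)"
    "(\<integral>\<^sup>+ x. e2ennreal (- g x) \<partial>M) = (\<integral>\<^sup>+ x. e2ennreal (- h x) \<partial>M)"
    by (rule nn_integral_cong_AE; use assms in \<open>eventually_elim, simp\<close>)+
  then show ?thesis
    by (simp add: ereal_integral_def)
qed

lemma ereal_integral_integrable:
  assumes "integrable M g"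
  shows "ereal_integral M (\<lambda>x. ereal (g x)) = ereal (integral\<^sup>L M g)"
proof -
  have "(\<integral>\<^sup>+ x. ennreal (g x) \<partial>M) < top" "(\<integral>\<^sup>+ x. ennreal (- g x) \<partial>M) < top"
    using assms by (auto simp: real_integrable_def less_top)
  then show ?thesis
    unfolding ereal_integral_def real_lebesgue_integral_def[OF assms]
    by (cases "(\<integral>\<^sup>+ x. ennreal (g x) \<partial>M)"; cases "(\<integral>\<^sup>+ x. ennreal (- g x) \<partial>M)") auto
qed

text \<open>By uniqueness of densities \<open>p\<close> and \<open>RN_deriv\<close> differ only on
  an \<open>M\<close>-null set, which is \<open>N\<close>-null too. No measurability of
  \<open>h\<close> enters, since \<open>ereal_integral\<close> respects equality almost everywhere
  for arbitrary functions.\<close>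

lemma ereal_integral_density_RN_deriv:
  assumes "sigma_finite_measure M" and [measurable]: "p \<in> borel_measurable M"
    and nn: "\<And>x. 0 \<le> p x" and N: "N = density M (\<lambda>x. ennreal (p x))"
  shows "ereal_integral N (\<lambda>x. ereal (h (enn2real (RN_deriv M N x)))) = ereal_integral N (\<lambda>x. ereal (h (p x)))"
proof (rule ereal_integral_cong_AE)
  interpret sigma_finite_measure M by fact
  have "AE x in M. ennreal (p x) = RN_deriv M N x"
    by (rule RN_deriv_unique) (auto simp: N)
  then have "AE x in M. enn2real (RN_deriv M N x) = p x"
    by eventually_elim (metis enn2real_ennreal nn)
  moreover have "absolutely_continuous M N"
    unfolding N by (rule absolutely_continuousI_density) simp
  ultimately have "AE x in N. enn2real (RN_deriv M N x) = p x"
    using absolutely_continuous_AE[of N M] N by simp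
  then show "AE x in N. ereal (h (enn2real (RN_deriv M N x))) = ereal (h (p x))"
    by eventually_elim simp
qed

lemma KL_eq_ereal_integral:
  assumes "sigma_finite_measure M" "p \<in> borel_measurable M"
    and "\<And>x. 0 \<le> p x" and N: "N = density M (\<lambda>x. ennreal (p x))"
  shows "KL N M = ereal_integral N (\<lambda>x. ereal (ln (p x)))"
proof -
  have "absolutely_continuous M N"
    unfolding N using assms(2) by (intro absolutely_continuousI_density) simp
  then show ?thesis
    using ereal_integral_density_RN_deriv[OF assms, of ln] by (simp add: KL_def N)
qed

lemma diff_entropy_density:
  assumes "p \<in> borel_measurable lborel"
    and "\<And>x. 0 \<le> p x" and N: "N = density lborel (\<lambda>x. ennreal (p x))"
  shows "diff_entropy N = ereal_integral N (\<lambda>x. ereal (- ln (p x)))"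
proof -
  have "absolutely_continuous lborel N"
    unfolding N using assms(1) by (intro absolutely_continuousI_density) simp
  then show ?thesis
    using ereal_integral_density_RN_deriv[OF lborel.sigma_finite_measure_axioms assms, of "\<lambda>t. - ln t"]
    by (simp add: diff_entropy_def N)
qed

text \<open>Positivity is claimed \<open>N\<close>-almost everywhere: \<open>N\<close> gives no mass
  to the zero set of its own density. So the value of \<open>ln\<close> at 0 never matters under
  \<open>N\<close>.\<close>

lemma obtain_real_density:
  assumes "sigma_finite_measure M" "finite_measure N" "absolutely_continuous M N" "sets N = sets M"
  obtains p where "p \<in> borel_measurable M" "\<And>x. 0 \<le> p x" "N = density M (\<lambda>x. ennreal (p x))"
    "AE x in N. 0 < p x"
proof -
  interpret sigma_finite_measure M by fact
  obtain p where p: "p \<in> borel_measurable M" "AE x in M. RN_deriv M N x = ennreal (p x)"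
    "AE x in N. 0 < p x" "\<And>x. 0 \<le> p x"
    using real_RN_deriv[OF assms(2-4)] by metis
  have "density M (\<lambda>x. ennreal (p x)) = density M (RN_deriv M N)"
    using p by (intro density_cong) auto
  then show thesis
    using p density_RN_deriv[OF assms(3,4)] by (intro that) auto
qed

text \<open>Because \<open>t * (- ln t) \<le> 1\<close>, the integral is at most the
  \<open>M\<close>-mass of any set carrying the measure. Applied to a probability measure
  \<open>M\<close> this bounds the negative part of a divergence; applied to Lebesgue measure on
  \<open>Y\<close> it bounds the positive part of an entropy.\<close>

lemma nn_integral_neg_ln_density_le:
  assumes [measurable]: "p \<in> borel_measurable M" and nn: "\<And>x. 0 \<le> p x"
    and A: "A \<in> sets M" and AE: "AE x in density M (\<lambda>x. ennreal (p x)). x \<in> A"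
  shows "(\<integral>\<^sup>+ x. ennreal (- ln (p x)) \<partial>density M (\<lambda>x. ennreal (p x))) \<le> emeasure M A"
proof -
  have le: "t * (- ln t) \<le> 1" if "0 < t" for t :: real
  proof -
    have "- ln t \<le> 1 / t - 1"
      using ln_le_minus_one[of "1/t"] that by (simp add: ln_div)
    then have "t * (- ln t) \<le> t * (1 / t - 1)"
      using that by (intro mult_left_mono) auto
    also have "\<dots> \<le> 1"
      using that by (simp add: field_simps)
    finally show ?thesis .
  qed
  have "(\<integral>\<^sup>+ x. ennreal (- ln (p x)) \<partial>density M (\<lambda>x. ennreal (p x)))
      = (\<integral>\<^sup>+ x. ennreal (p x) * ennreal (- ln (p x)) \<partial>M)"
    by (rule nn_integral_density) auto
  also have "\<dots> \<le> (\<integral>\<^sup>+ x. indicator A x \<partial>M)"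
  proof (rule nn_integral_mono_AE)
    have "AE x in M. 0 < p x \<longrightarrow> x \<in> A"
      using AE by (simp add: AE_density)
    then show "AE x in M. ennreal (p x) * ennreal (- ln (p x)) \<le> indicator A x"
    proof eventually_elim
      case (elim x)
      show ?case
      proof (cases "p x = 0")
        case False
        then have "0 < p x" using nn[of x] by simp
        then show ?thesis
          using elim le[of "p x"] by (simp flip: ennreal_mult' add: ennreal_le_1)
      qed simp
    qed
  qed
  finally show ?thesis
    using A by simp
qed

section \<open>Data processing inequality\<close>

lemma KL_distr_le:
  assumes "prob_space M" "prob_space N" and T[measurable]: "T \<in> M \<rightarrow>\<^sub>M M'"
  shows "KL (distr N M' T) (distr M M' T) \<le> KL N M"
proof (cases "KL N M = \<infinity>")
  case False
  interpret M: prob_space M by fact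
  interpret N: prob_space N by fact
  have ac: "absolutely_continuous M N" and sets: "sets N = sets M"
    using False by (auto simp: KL_def split: if_splits)
  note [measurable_cong] = sets
  obtain r where [measurable]: "r \<in> borel_measurable M" and r_nn: "\<And>x. 0 \<le> r x"
    and N: "N = density M (\<lambda>x. ennreal (r x))" and r_pos: "AE x in N. 0 < r x"
    using obtain_real_density[OF M.sigma_finite_measure_axioms N.finite_measure_axioms ac sets] by blast
  have rN[measurable]: "r \<in> borel_measurable N"
    by measurable
  let ?M = "distr M M' T" and ?N = "distr N M' T"
  have T_N[measurable]: "T \<in> N \<rightarrow>\<^sub>M M'" by measurable
  interpret TM: prob_space ?M by (rule M.prob_space_distr) measurable
  interpret TN: prob_space ?N by (rule N.prob_space_distr) measurable
  have "absolutely_continuous ?M ?N"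
    unfolding absolutely_continuous_def
  proof
    fix A assume "A \<in> null_sets ?M"
    then have "A \<in> sets M'" "T -` A \<inter> space M \<in> null_sets M"
      by (auto simp: null_sets_def emeasure_distr)
    with ac have "T -` A \<inter> space M \<in> null_sets N"
      by (auto simp: absolutely_continuous_def)
    then show "A \<in> null_sets ?N"
      using \<open>A \<in> sets M'\<close> sets_eq_imp_space_eq[OF sets] by (auto simp: null_sets_def emeasure_distr)
  qed
  then obtain q where q[measurable]: "q \<in> borel_measurable ?M" and q_nn: "\<And>x. 0 \<le> q x"
    and TN: "?N = density ?M (\<lambda>x. ennreal (q x))" and q_pos: "AE x in ?N. 0 < q x"
    using obtain_real_density[OF TM.sigma_finite_measure_axioms TN.finite_measure_axioms] by auto
  have q_M'[measurable]: "q \<in> borel_measurable M'"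
    using q by simp
  have KL1: "KL N M = ereal_integral N (\<lambda>x. ereal (ln (r x)))"
    by (rule KL_eq_ereal_integral[OF M.sigma_finite_measure_axioms]) (use N r_nn in auto)
  have KL2: "KL ?N ?M = ereal_integral ?N (\<lambda>x. ereal (ln (q x)))"
    by (rule KL_eq_ereal_integral[OF TM.sigma_finite_measure_axioms q q_nn TN])
  \<comment> \<open>With a finite negative part, \<open>KL N M\<close> can be finite only if the
    positive part is finite as well, so \<open>ln r\<close> is integrable.\<close>
  have neg1: "(\<integral>\<^sup>+ x. ennreal (- ln (r x)) \<partial>N) < top"
  proof -
    have "(\<integral>\<^sup>+ x. ennreal (- ln (r x)) \<partial>N) \<le> emeasure M (space M)"
      unfolding N by (rule nn_integral_neg_ln_density_le) (auto simp: r_nn AE_density)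
    then show ?thesis
      by (simp add: M.emeasure_space_1 order_le_less_trans)
  qed
  have neg2: "(\<integral>\<^sup>+ x. ennreal (- ln (q x)) \<partial>?N) < top"
  proof -
    have "(\<integral>\<^sup>+ x. ennreal (- ln (q x)) \<partial>?N) \<le> emeasure ?M (space ?M)"
      unfolding TN by (rule nn_integral_neg_ln_density_le) (auto simp: q_nn AE_density)
    then show ?thesis
      by (simp add: TM.emeasure_space_1 order_le_less_trans del: space_distr)
  qed
  have pos1: "(\<integral>\<^sup>+ x. ennreal (ln (r x)) \<partial>N) < top"
  proof (rule ccontr)
    assume "\<not> ?thesis"
    then have "(\<integral>\<^sup>+ x. ennreal (ln (r x)) \<partial>N) = top"
      by (simp flip: less_top)
    then have "KL N M = \<infinity>"
      using neg1 by (simp add: KL1 ereal_integral_def)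
    with False show False by simp
  qed
  have int1: "integrable N (\<lambda>x. ln (r x))"
    using pos1 neg1 by (simp add: real_integrable_def less_top)
  have q_pos': "AE x in N. 0 < q (T x)"
    using q_pos by (subst (asm) AE_distr_iff) auto
  \<comment> \<open>In general only an inequality: \<open>N\<close> does not see the set where
    \<open>r\<close> vanishes, on which \<open>q (T x)\<close> may still have positive
    \<open>M\<close>-integral.\<close>
  have nn_qr: "(\<integral>\<^sup>+ x. ennreal (q (T x) / r x) \<partial>N) \<le> 1"
  proof -
    have "(\<integral>\<^sup>+ x. ennreal (q (T x) / r x) \<partial>N) = (\<integral>\<^sup>+ x. ennreal (r x) * ennreal (q (T x) / r x) \<partial>M)"
      unfolding N by (rule nn_integral_density) auto
    also have "\<dots> \<le> (\<integral>\<^sup>+ x. ennreal (q (T x)) \<partial>M)"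
    proof (rule nn_integral_mono)
      fix x
      show "ennreal (r x) * ennreal (q (T x) / r x) \<le> ennreal (q (T x))"
        using r_nn[of x] q_nn[of "T x"] by (cases "r x = 0") (auto simp flip: ennreal_mult')
    qed
    also have "\<dots> = (\<integral>\<^sup>+ x. ennreal (q x) \<partial>?M)"
      by (rule nn_integral_distr[symmetric]) auto
    also have "\<dots> = emeasure ?N (space ?N)"
      unfolding TN by (subst emeasure_density) (auto intro!: nn_integral_cong)
    finally show ?thesis
      using TN.emeasure_space_1 by simp
  qed
  have int_qr: "integrable N (\<lambda>x. q (T x) / r x)"
  proof (rule integrableI_nonneg)
    show "(\<integral>\<^sup>+ x. ennreal (q (T x) / r x) \<partial>N) < \<infinity>"
      using nn_qr by (simp add: order_le_less_trans)
  qed (use q_nn r_nn in auto)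
  have qr_le: "(\<integral>x. q (T x) / r x \<partial>N) \<le> 1"
    using nn_qr q_nn r_nn nn_integral_eq_integral[OF int_qr] by simp
  have ln_le: "AE x in N. ln (q (T x)) \<le> ln (r x) + q (T x) / r x - 1"
    using r_pos q_pos'
  proof eventually_elim
    case (elim x)
    then show ?case
      using ln_le_minus_one[of "q (T x) / r x"] by (simp add: ln_div)
  qed
  \<comment> \<open>Integrability of \<open>ln q\<close> must precede any comparison of integrals.
    The pointwise bound is made nonnegative by dropping the \<open>- 1\<close> and cutting
    \<open>ln r\<close> at 0.\<close>
  have "(\<integral>\<^sup>+ x. ennreal (ln (q x)) \<partial>?N) = (\<integral>\<^sup>+ x. ennreal (ln (q (T x))) \<partial>N)"
    by (rule nn_integral_distr) auto
  also have "\<dots> \<le> (\<integral>\<^sup>+ x. ennreal (ln (r x)) + ennreal (q (T x) / r x) \<partial>N)"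
  proof (rule nn_integral_mono_AE, use ln_le in eventually_elim)
    case (elim x)
    have "ln (q (T x)) \<le> max 0 (ln (r x)) + q (T x) / r x"
      using elim by linarith
    then have "ennreal (ln (q (T x))) \<le> ennreal (max 0 (ln (r x)) + q (T x) / r x)"
      by (rule ennreal_leI)
    also have "\<dots> = ennreal (ln (r x)) + ennreal (q (T x) / r x)"
      using r_nn[of x] q_nn[of "T x"] by (simp add: ennreal_max_0)
    finally show ?case .
  qed
  also have "\<dots> = (\<integral>\<^sup>+ x. ennreal (ln (r x)) \<partial>N) + (\<integral>\<^sup>+ x. ennreal (q (T x) / r x) \<partial>N)"
    by (rule nn_integral_add) auto
  also have "\<dots> < top"
    using pos1 nn_qr by (simp add: order_le_less_trans)
  finally have int2: "integrable ?N (\<lambda>x. ln (q x))"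
    using neg2 by (simp add: real_integrable_def less_top)
  have int2': "integrable N (\<lambda>x. ln (q (T x)))"
    using int2 by (subst (asm) integrable_distr_eq) auto
  have "(\<integral>x. ln (q x) \<partial>?N) = (\<integral>x. ln (q (T x)) \<partial>N)"
    by (rule integral_distr) auto
  also have "\<dots> \<le> (\<integral>x. ln (r x) + q (T x) / r x - 1 \<partial>N)"
    using ln_le int1 int_qr int2' by (intro integral_mono_AE) auto
  also have "\<dots> = (\<integral>x. ln (r x) \<partial>N) + (\<integral>x. q (T x) / r x \<partial>N) - 1"
    using int1 int_qr N.prob_space by simp
  also have "\<dots> \<le> (\<integral>x. ln (r x) \<partial>N)"
    using qr_le by simp
  finally show ?thesis
    by (simp add: KL1 KL2 ereal_integral_integrable[OF int1] ereal_integral_integrable[OF int2])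
qed simp

section \<open>Conditional densities and an entropy bound\<close>

text \<open>For fixed \<open>B\<close>, both masses of \<open>B\<close> are, as functions of
  \<open>x\<close>, densities of \<open>A \<mapsto> \<pi> (A \<times> B)\<close> with respect to
  \<open>P\<close>, hence equal almost everywhere. The exceptional set depends on \<open>B\<close>,
  so this is used only for countably many \<open>B\<close> that form an intersection-stable
  generator; equality of the measures then follows for all other \<open>x\<close>.\<close>

lemma cond_kernel_density:
  fixes \<kappa> :: "'x \<Rightarrow> 'y::euclidean_space measure"
  assumes "prob_space P" and ck: "cond_kernel P \<pi> \<kappa>"
    and g[measurable]: "g \<in> borel_measurable (P \<Otimes>\<^sub>M lborel)"
    and \<pi>: "\<pi> = density (P \<Otimes>\<^sub>M lborel) g"
  shows "AE x in P. \<kappa> x = density lborel (\<lambda>y. g (x, y))"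
proof -
  interpret P: prob_space P by fact
  have \<kappa>: "\<kappa> \<in> P \<rightarrow>\<^sub>M prob_algebra lborel"
    and em: "\<And>A. A \<in> sets (P \<Otimes>\<^sub>M lborel) \<Longrightarrow> emeasure \<pi> A = (\<integral>\<^sup>+ x. emeasure (\<kappa> x) (Pair x -` A) \<partial>P)"
    using ck by (auto simp: cond_kernel_def)
  have eq: "AE x in P. emeasure (\<kappa> x) B = emeasure (density lborel (\<lambda>y. g (x, y))) B"
    if B[measurable]: "B \<in> sets borel" for B :: "'y set"
  proof -
    have B': "B \<in> sets lborel" using B by simp
    let ?u = "\<lambda>x. \<integral>\<^sup>+ y. g (x, y) * indicator B y \<partial>lborel"
    have [measurable]: "(\<lambda>x. emeasure (\<kappa> x) B) \<in> borel_measurable P"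
      by (rule measurable_compose[OF measurable_prob_algebraD[OF \<kappa>] measurable_emeasure_subprob_algebra[OF B']])
    have u[measurable]: "?u \<in> borel_measurable P"
      by measurable
    have "AE x in P. emeasure (\<kappa> x) B = ?u x"
    proof (rule P.density_unique_finite_measure)
      fix A assume A[measurable]: "A \<in> sets P"
      have AB: "A \<times> B \<in> sets (P \<Otimes>\<^sub>M lborel)" by simp
      have "(\<integral>\<^sup>+ x. emeasure (\<kappa> x) B * indicator A x \<partial>P) = (\<integral>\<^sup>+ x. emeasure (\<kappa> x) (Pair x -` (A \<times> B)) \<partial>P)"
        by (intro nn_integral_cong) (auto split: split_indicator)
      also have "\<dots> = emeasure \<pi> (A \<times> B)"
        using em[OF AB] by simp
      also have "\<dots> = (\<integral>\<^sup>+ z. g z * indicator (A \<times> B) z \<partial>(P \<Otimes>\<^sub>M lborel))"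
        unfolding \<pi> by (rule emeasure_density) (use AB in auto)
      also have "\<dots> = (\<integral>\<^sup>+ x. \<integral>\<^sup>+ y. g (x, y) * indicator (A \<times> B) (x, y) \<partial>lborel \<partial>P)"
        by (rule lborel.nn_integral_fst[symmetric]) measurable
      also have "\<dots> = (\<integral>\<^sup>+ x. ?u x * indicator A x \<partial>P)"
        by (intro nn_integral_cong) (auto split: split_indicator simp: indicator_times)
      finally show "(\<integral>\<^sup>+ x. emeasure (\<kappa> x) B * indicator A x \<partial>P) = (\<integral>\<^sup>+ x. ?u x * indicator A x \<partial>P)" .
    qed auto
    then show ?thesis
    proof (rule AE_mp, intro AE_I2 impI)
      fix x assume x[measurable]: "x \<in> space P" and e: "emeasure (\<kappa> x) B = ?u x"
      show "emeasure (\<kappa> x) B = emeasure (density lborel (\<lambda>y. g (x, y))) B"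
        unfolding e by (rule emeasure_density[symmetric]) auto
    qed
  qed
  obtain B :: "'y set set" where B: "countable B" "topological_basis B"
    using ex_countable_basis by blast
  \<comment> \<open>A countable basis need not be closed under intersections, so finite
    intersections are added. The empty family contributes \<open>UNIV\<close>, the covering set of
    finite mass that the uniqueness theorem asks for.\<close>
  define E where "E = Inter ` {F. finite F \<and> F \<subseteq> B}"
  have "countable E"
    unfolding E_def by (intro countable_image countable_Collect_finite_subset B)
  have "Int_stable E"
    unfolding Int_stable_def E_def
  proof (intro ballI)
    fix a b assume "a \<in> Inter ` {F. finite F \<and> F \<subseteq> B}" "b \<in> Inter ` {F. finite F \<and> F \<subseteq> B}"
    then obtain F G where "finite F" "F \<subseteq> B" "finite G" "G \<subseteq> B" "a = \<Inter>F" "b = \<Inter>G" by auto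
    then show "a \<inter> b \<in> Inter ` {F. finite F \<and> F \<subseteq> B}"
      by (intro image_eqI[of _ _ "F \<union> G"]) auto
  qed
  have E_open: "open e" if "e \<in> E" for e
    using that topological_basis_open[OF B(2)] unfolding E_def by auto
  have "B \<subseteq> E"
  proof
    fix b assume "b \<in> B" then show "b \<in> E"
      unfolding E_def by (intro image_eqI[of _ _ "{b}"]) auto
  qed
  have "UNIV \<in> E"
    unfolding E_def by (intro image_eqI[of _ _ "{}"]) auto
  have "sets (borel :: 'y measure) = sigma_sets UNIV B"
    by (subst borel_eq_countable_basis[OF B]) simp
  moreover have "E \<subseteq> sets borel"
    using E_open by auto
  then have "sigma_sets UNIV E \<subseteq> sets borel"
    using sets.sigma_sets_subset[of E borel] by simp
  ultimately have sets_E: "sets (borel :: 'y measure) = sigma_sets UNIV E"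
    using sigma_sets_mono'[OF \<open>B \<subseteq> E\<close>, of UNIV] by simp
  have "AE x in P. \<forall>e\<in>E. emeasure (\<kappa> x) e = emeasure (density lborel (\<lambda>y. g (x, y))) e"
    using \<open>countable E\<close> eq E_open by (simp add: AE_ball_countable)
  then show ?thesis
  proof (rule AE_mp, intro AE_I2 impI)
    fix x assume x: "x \<in> space P"
      and e: "\<forall>e\<in>E. emeasure (\<kappa> x) e = emeasure (density lborel (\<lambda>y. g (x, y))) e"
    have \<kappa>x: "sets (\<kappa> x) = sets lborel" "prob_space (\<kappa> x)"
      using measurable_space[OF \<kappa> x] by (auto simp: space_prob_algebra)
    interpret prob_space "\<kappa> x" by fact
    show "\<kappa> x = density lborel (\<lambda>y. g (x, y))"
      by (rule measure_eqI_generator_eq[OF \<open>Int_stable E\<close>, where \<Omega>=UNIV and A="\<lambda>_. UNIV"])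
        (use e \<kappa>x sets_E \<open>UNIV \<in> E\<close> in auto)
  qed
qed

text \<open>A cruder bound than the logarithm of the volume, but only finiteness matters later. If
  \<open>\<mu>\<close> has no density, its entropy \<open>-\<infinity>\<close> is cut to 0 by
  \<open>e2ennreal\<close>.\<close>

lemma diff_entropy_nonneg_part_le:
  assumes "\<mu> \<in> probs_on Y" and Y: "Y \<in> sets borel"
  shows "e2ennreal (diff_entropy \<mu>) \<le> emeasure lborel Y"
proof (cases "absolutely_continuous lborel \<mu>")
  case True
  interpret prob_space \<mu> using assms by (simp add: probs_on_def)
  have sets: "sets \<mu> = sets lborel" and Y1: "emeasure \<mu> Y = 1"
    using assms by (auto simp: probs_on_def)
  obtain p where p: "p \<in> borel_measurable lborel" "\<And>x. 0 \<le> p x" "\<mu> = density lborel (\<lambda>x. ennreal (p x))"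
    using obtain_real_density[OF lborel.sigma_finite_measure_axioms finite_measure_axioms True sets] by blast
  have "AE x in \<mu>. x \<in> Y"
    using Y1 Y sets by (intro AE_prob_1) (simp add: emeasure_eq_measure)
  then have *: "(\<integral>\<^sup>+ x. ennreal (- ln (p x)) \<partial>\<mu>) \<le> emeasure lborel Y"
    unfolding p(3) using p(1,2) Y by (intro nn_integral_neg_ln_density_le) auto
  have "diff_entropy \<mu> \<le> enn2ereal (\<integral>\<^sup>+ x. ennreal (- ln (p x)) \<partial>\<mu>)"
    unfolding diff_entropy_density[OF p] ereal_integral_def
    by (simp add: ereal_diff_le_self)
  then have "e2ennreal (diff_entropy \<mu>) \<le> (\<integral>\<^sup>+ x. ennreal (- ln (p x)) \<partial>\<mu>)"
    using e2ennreal_mono by fastforce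
  with * show ?thesis by simp
qed (simp add: diff_entropy_def e2ennreal_neg)

section \<open>The Gibbs plans \<open>pi_f\<close>\<close>

text \<open>The indicator of \<open>Y\<close> hides the values off \<open>Y\<close>, and
  \<open>P\<close> does not charge the complement of \<open>X\<close>. This permits replacing cost
  and potential by their extensions by 0.\<close>

lemma pi_f_cong:
  assumes X: "X \<in> sets P" "emeasure P (space P - X) = 0"
    and c: "\<And>x y. x \<in> X \<Longrightarrow> y \<in> Y \<Longrightarrow> c (x, y) = c' (x, y)" and f: "\<And>y. y \<in> Y \<Longrightarrow> f y = f' y"
  shows "pi_f c Y \<epsilon> P f = pi_f c' Y \<epsilon> P f'"
proof -
  have Z: "Zc c Y \<epsilon> f x = Zc c' Y \<epsilon> f' x" if "x \<in> X" for x
    unfolding Zc_def set_lebesgue_integral_def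
    by (intro Bochner_Integration.integral_cong) (auto simp: that c f split: split_indicator)
  have "(space P - X) \<times> UNIV \<in> null_sets (P \<Otimes>\<^sub>M lborel)"
    using X by (intro null_setsI) (auto simp: lborel.emeasure_pair_measure_Times)
  then have "AE z in P \<Otimes>\<^sub>M lborel. z \<notin> (space P - X) \<times> UNIV"
    by (rule AE_not_in)
  then have AE: "AE z in P \<Otimes>\<^sub>M (lborel :: 'b measure). fst z \<in> X"
    by (rule AE_mp, intro AE_I2) (auto simp: space_pair_measure)
  show ?thesis
    unfolding pi_f_def density_def
    by (intro arg_cong2[where f="measure_of _"] refl ext nn_integral_cong_AE,
        use AE in eventually_elim) (auto simp: Z c f split: split_indicator)
qed

text \<open>Compactness and continuity are distilled into measurability, global bounds and the
  finite volume of \<open>Y\<close>. The extensions by 0 of a continuous cost and potential satisfy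
  these assumptions.\<close>

locale bounded_cost = prob_space P for P :: "'x measure" +
  fixes Y :: "'y::euclidean_space set" and c :: "'x \<times> 'y \<Rightarrow> real" and f :: "'y \<Rightarrow> real"
    and \<epsilon> C F :: real
  assumes Y[measurable]: "Y \<in> sets borel"
    and Y_pos: "0 < emeasure lborel Y" and Y_fin: "emeasure lborel Y < top"
    and c[measurable]: "c \<in> borel_measurable (P \<Otimes>\<^sub>M lborel)" and c_bd: "\<And>z. \<bar>c z\<bar> \<le> C"
    and f[measurable]: "f \<in> borel_measurable borel" and f_bd: "\<And>y. \<bar>f y\<bar> \<le> F"
    and eps: "0 < \<epsilon>"
begin

abbreviation "Z \<equiv> Zc c Y \<epsilon> f"
abbreviation "\<nu> \<equiv> P \<Otimes>\<^sub>M (lborel :: 'y measure)"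

lemma pair_sigma_finite_P: "pair_sigma_finite P (lborel :: 'y measure)"
  by standard

lemma Y_measure: "emeasure lborel Y = ennreal (measure lborel Y)" "0 < measure lborel Y"
proof -
  show "emeasure lborel Y = ennreal (measure lborel Y)"
    using Y_fin by (intro emeasure_eq_ennreal_measure) auto
  then show "0 < measure lborel Y"
    using Y_pos by simp
qed

lemma exponent_bounds: "\<bar>(f y - c (x, y)) / \<epsilon>\<bar> \<le> (F + C) / \<epsilon>"
  using f_bd[of y] c_bd[of "(x, y)"] eps by (simp add: abs_divide divide_right_mono)

lemma integrable_Gibbs:
  assumes [measurable]: "x \<in> space P"
  shows "integrable lborel (\<lambda>y. indicator Y y * exp ((f y - c (x, y)) / \<epsilon>))"
proof (rule Bochner_Integration.integrable_bound)
  show "integrable lborel (\<lambda>y. indicator Y y * exp ((F + C) / \<epsilon>) :: real)"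
    using Y_fin by (intro integrable_mult_left) (auto intro!: integrable_real_indicator)
  show "AE y in lborel. norm (indicator Y y * exp ((f y - c (x, y)) / \<epsilon>)) \<le> norm (indicator Y y * exp ((F + C) / \<epsilon>) :: real)"
    using abs_le_D1[OF exponent_bounds[of _ x]] by (intro AE_I2) (auto split: split_indicator)
qed measurable

lemma Z_eq: "Z x = (\<integral>y. indicator Y y * exp ((f y - c (x, y)) / \<epsilon>) \<partial>lborel)"
  by (simp add: Zc_def set_lebesgue_integral_def)

text \<open>The bounds are uniform in \<open>x\<close>, and the lower one is positive because
  \<open>Y\<close> has positive volume. Hence \<open>ln Z\<close> is bounded and the transform is
  integrable.\<close>

lemma Z_bounds:
  assumes x: "x \<in> space P"
  shows "exp (- ((F + C) / \<epsilon>)) * measure lborel Y \<le> Z x" "Z x \<le> exp ((F + C) / \<epsilon>) * measure lborel Y"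
proof -
  have int: "integrable lborel (\<lambda>y. indicator Y y * a)" for a :: real
    using Y_fin by (intro integrable_mult_left) (auto intro!: integrable_real_indicator)
  have bd: "- ((F + C) / \<epsilon>) \<le> (f y - c (x, y)) / \<epsilon>" "(f y - c (x, y)) / \<epsilon> \<le> (F + C) / \<epsilon>" for y
    using exponent_bounds[of y x] by linarith+
  have "exp (- ((F + C) / \<epsilon>)) * measure lborel Y = (\<integral>y. indicator Y y * exp (- ((F + C) / \<epsilon>)) \<partial>lborel)"
    by simp
  also have "\<dots> \<le> Z x"
    unfolding Z_eq by (intro integral_mono int integrable_Gibbs x) (use bd in \<open>auto split: split_indicator\<close>)
  finally show "exp (- ((F + C) / \<epsilon>)) * measure lborel Y \<le> Z x" .
  have "Z x \<le> (\<integral>y. indicator Y y * exp ((F + C) / \<epsilon>) \<partial>lborel)"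
    unfolding Z_eq by (intro integral_mono int integrable_Gibbs x) (use bd in \<open>auto split: split_indicator\<close>)
  then show "Z x \<le> exp ((F + C) / \<epsilon>) * measure lborel Y"
    by (simp add: mult.commute)
qed

lemma Z_pos: "x \<in> space P \<Longrightarrow> 0 < Z x"
  using Z_bounds(1)[of x] Y_measure(2) by (smt (verit) exp_gt_zero mult_pos_pos)

lemma Z_measurable[measurable]: "Z \<in> borel_measurable P"
  unfolding Z_eq[abs_def] by measurable

lemma ln_Z_bounded: obtains B where "\<And>x. x \<in> space P \<Longrightarrow> \<bar>ln (Z x)\<bar> \<le> B"
proof (rule that)
  fix x assume x: "x \<in> space P"
  let ?L = "ln (exp (- ((F + C) / \<epsilon>)) * measure lborel Y)" and ?U = "ln (exp ((F + C) / \<epsilon>) * measure lborel Y)"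
  have "?L \<le> ln (Z x)" "ln (Z x) \<le> ?U"
    using Z_bounds[OF x] Z_pos[OF x] Y_measure(2) by (auto intro!: ln_mono)
  then show "\<bar>ln (Z x)\<bar> \<le> \<bar>?L\<bar> + \<bar>?U\<bar>" by linarith
qed

text \<open>On \<open>Y\<close> this is the logarithm of the density of \<open>pi_f\<close>.
  Multiplied by \<open>\<epsilon>\<close> it equals potential plus transform minus cost. The
  indicator of \<open>Y\<close> is kept apart so that the function stays real-valued.\<close>

definition "log_dens z = (f (snd z) - c z) / \<epsilon> - ln (Z (fst z))"

lemma log_dens_measurable[measurable]: "log_dens \<in> borel_measurable \<nu>"
  unfolding log_dens_def[abs_def] by measurable

lemma pi_f_eq: "pi_f c Y \<epsilon> P f = density \<nu> (\<lambda>z. ennreal (indicator Y (snd z) * exp (log_dens z)))"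
  unfolding pi_f_def
proof (rule density_cong)
  show "AE z in \<nu>. (case z of (x, y) \<Rightarrow> ennreal (indicator Y y * exp ((f y - c (x, y)) / \<epsilon>) / Z x))
      = ennreal (indicator Y (snd z) * exp (log_dens z))"
    by (intro AE_I2) (auto simp: space_pair_measure log_dens_def exp_diff Z_pos)
qed measurable

lemma prob_space_pi_f: "prob_space (pi_f c Y \<epsilon> P f)"
proof
  have m: "(\<lambda>z. ennreal (indicator Y (snd z) * exp (log_dens z))) \<in> borel_measurable \<nu>"
    by measurable
  have "emeasure (pi_f c Y \<epsilon> P f) (space (pi_f c Y \<epsilon> P f))
      = (\<integral>\<^sup>+ z. ennreal (indicator Y (snd z) * exp (log_dens z)) \<partial>\<nu>)"
    unfolding pi_f_eq space_density
    by (subst emeasure_density[OF m sets.top]) (auto intro!: nn_integral_cong)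
  also have "\<dots> = (\<integral>\<^sup>+ x. \<integral>\<^sup>+ y. ennreal (indicator Y (snd (x, y)) * exp (log_dens (x, y))) \<partial>lborel \<partial>P)"
    by (rule lborel.nn_integral_fst[symmetric]) measurable
  also have "\<dots> = (\<integral>\<^sup>+ x. 1 \<partial>P)"
  proof (rule nn_integral_cong)
    fix x assume x: "x \<in> space P"
    have "(\<integral>\<^sup>+ y. ennreal (indicator Y (snd (x, y)) * exp (log_dens (x, y))) \<partial>lborel)
        = (\<integral>\<^sup>+ y. ennreal (indicator Y y * exp ((f y - c (x, y)) / \<epsilon>) / Z x) \<partial>lborel)"
      using Z_pos[OF x] by (simp add: log_dens_def exp_diff)
    also have "\<dots> = ennreal (\<integral>y. indicator Y y * exp ((f y - c (x, y)) / \<epsilon>) / Z x \<partial>lborel)"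
      using integrable_Gibbs[OF x] Z_pos[OF x] by (intro nn_integral_eq_integral) (auto simp: less_imp_le)
    also have "\<dots> = 1"
      using Z_pos[OF x] by (simp flip: Z_eq)
    finally show "(\<integral>\<^sup>+ y. ennreal (indicator Y (snd (x, y)) * exp (log_dens (x, y))) \<partial>lborel) = 1" .
  qed
  finally show "emeasure (pi_f c Y \<epsilon> P f) (space (pi_f c Y \<epsilon> P f)) = 1"
    by (simp add: emeasure_space_1)
qed

end

section \<open>Arbitrary plans and their divergence from the Gibbs plan\<close>

text \<open>No optimality is assumed: the gap identity holds for every plan of finite objective, and
  minimality only identifies the objective with \<open>EOT\<close>.\<close>

locale bounded_cost_plan = bounded_cost P Y c f \<epsilon> C F
  for P :: "'x measure" and Y :: "'y::euclidean_space set" and c f \<epsilon> C F +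
  fixes Q \<pi> \<kappa>
  assumes Q: "Q \<in> probs_on Y" and coupling: "coupling P Q \<pi>" and kernel: "cond_kernel P \<pi> \<kappa>"
begin

lemma sets_\<pi>[measurable_cong]: "sets \<pi> = sets \<nu>"
  using coupling by (simp add: coupling_def)

lemma space_\<pi>: "space \<pi> = space \<nu>"
  by (rule sets_eq_imp_space_eq[OF sets_\<pi>])

lemma distr_fst: "distr \<pi> P fst = P" and distr_snd: "distr \<pi> lborel snd = Q"
  using coupling by (auto simp: coupling_def)

lemma kernel_measurable: "\<kappa> \<in> P \<rightarrow>\<^sub>M prob_algebra lborel"
  and emeasure_\<pi>: "A \<in> sets \<nu> \<Longrightarrow> emeasure \<pi> A = (\<integral>\<^sup>+ x. emeasure (\<kappa> x) (Pair x -` A) \<partial>P)"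
  using kernel by (auto simp: cond_kernel_def)

lemma kernel_prob: "x \<in> space P \<Longrightarrow> prob_space (\<kappa> x) \<and> sets (\<kappa> x) = sets lborel"
  using measurable_space[OF kernel_measurable] by (auto simp: space_prob_algebra)

lemma prob_space_\<pi>: "prob_space \<pi>"
proof (rule prob_space_distrD)
  show "fst \<in> \<pi> \<rightarrow>\<^sub>M P" by measurable
  show "prob_space (distr \<pi> P fst)" unfolding distr_fst by (rule prob_space_axioms)
qed

lemma AE_\<pi>_Y: "AE z in \<pi>. snd z \<in> Y"
proof -
  interpret Q: prob_space Q using Q by (simp add: probs_on_def)
  have "AE y in Q. y \<in> Y"
    using Q by (intro Q.AE_prob_1) (simp add: Q.emeasure_eq_measure probs_on_def)
  then have "AE y in distr \<pi> lborel snd. y \<in> Y"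
    unfolding distr_snd .
  then show ?thesis
    by (subst (asm) AE_distr_iff) auto
qed

text \<open>The \<open>P\<close>-average of the masses that the \<open>\<kappa> x\<close> give to
  \<open>- Y\<close> is the mass that \<open>Q\<close> gives to \<open>- Y\<close>, which is
  0.\<close>

lemma AE_kernel_probs_on: "AE x in P. \<kappa> x \<in> probs_on Y"
proof -
  have sub: "space P \<times> (- Y) \<in> sets \<nu>" by measurable
  have "AE z in \<pi>. z \<notin> space P \<times> (- Y)"
    using AE_\<pi>_Y by eventually_elim auto
  then have "emeasure \<pi> (space P \<times> (- Y)) = 0"
    using sub AE_iff_null_sets[of "space P \<times> (- Y)" \<pi>] unfolding sets_\<pi> by blast
  then have "(\<integral>\<^sup>+ x. emeasure (\<kappa> x) (- Y) \<partial>P) = 0"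
    unfolding emeasure_\<pi>[OF sub] by (subst nn_integral_cong[where v="\<lambda>x. emeasure (\<kappa> x) (Pair x -` (space P \<times> (- Y)))"]) auto
  moreover have "(\<lambda>x. emeasure (\<kappa> x) (- Y)) \<in> borel_measurable P"
    by (rule measurable_compose[OF measurable_prob_algebraD[OF kernel_measurable] measurable_emeasure_subprob_algebra]) simp
  ultimately have "AE x in P. emeasure (\<kappa> x) (- Y) = 0"
    by (simp add: nn_integral_0_iff_AE)
  then show ?thesis
  proof (rule AE_mp, intro AE_I2 impI)
    fix x assume x: "x \<in> space P" and 0: "emeasure (\<kappa> x) (- Y) = 0"
    interpret \<kappa>: prob_space "\<kappa> x" using kernel_prob[OF x] by simp
    have sets: "sets (\<kappa> x) = sets borel" "space (\<kappa> x) = UNIV"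
      using kernel_prob[OF x] sets_eq_imp_space_eq[of "\<kappa> x" lborel] by auto
    have "emeasure (\<kappa> x) (space (\<kappa> x) - (- Y)) = emeasure (\<kappa> x) (space (\<kappa> x)) - emeasure (\<kappa> x) (- Y)"
      by (rule emeasure_compl) (auto simp: sets)
    then have "emeasure (\<kappa> x) Y = 1"
      using 0 \<kappa>.emeasure_space_1 by (simp add: sets)
    then show "\<kappa> x \<in> probs_on Y"
      using kernel_prob[OF x] by (simp add: probs_on_def)
  qed
qed

lemma nn_integral_entropy_pos_part: "(\<integral>\<^sup>+ x. e2ennreal (diff_entropy (\<kappa> x)) \<partial>P) \<le> emeasure lborel Y"
proof -
  have "(\<integral>\<^sup>+ x. e2ennreal (diff_entropy (\<kappa> x)) \<partial>P) \<le> (\<integral>\<^sup>+ x. emeasure lborel Y \<partial>P)"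
    by (rule nn_integral_mono_AE, use AE_kernel_probs_on in eventually_elim)
      (rule diff_entropy_nonneg_part_le[OF _ Y])
  then show ?thesis by (simp add: emeasure_space_1)
qed

text \<open>Since \<open>\<infinity> - \<infinity> = \<infinity>\<close> in \<open>ereal\<close>, it
  is the finiteness of the positive part that excludes this value. Consequently the objective is
  never \<open>-\<infinity>\<close>.\<close>

lemma entropy_lt_PInf: "ereal_integral P (\<lambda>x. diff_entropy (\<kappa> x)) \<noteq> \<infinity>"
  unfolding ereal_integral_def
  using order_le_less_trans[OF nn_integral_entropy_pos_part Y_fin]
  by (cases "\<integral>\<^sup>+ x. e2ennreal (diff_entropy (\<kappa> x)) \<partial>P";
      cases "\<integral>\<^sup>+ x. e2ennreal (- diff_entropy (\<kappa> x)) \<partial>P") auto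

text \<open>This is the case of finite objective: the assumption supplies the bound on the averaged
  entropy that the volume of \<open>Y\<close> does not.\<close>

context
  assumes entropy: "ereal_integral P (\<lambda>x. diff_entropy (\<kappa> x)) \<noteq> -\<infinity>"
begin

lemma nn_integral_entropy_neg_part: "(\<integral>\<^sup>+ x. e2ennreal (- diff_entropy (\<kappa> x)) \<partial>P) < top"
  using entropy unfolding ereal_integral_def
  using order_le_less_trans[OF nn_integral_entropy_pos_part Y_fin]
  by (cases "\<integral>\<^sup>+ x. e2ennreal (diff_entropy (\<kappa> x)) \<partial>P";
      cases "\<integral>\<^sup>+ x. e2ennreal (- diff_entropy (\<kappa> x)) \<partial>P") auto

text \<open>If \<open>\<pi>\<close> charged a \<open>\<nu>\<close>-null set \<open>N\<close>, then \<open>\<kappa> x\<close> would charge the null section of \<open>N\<close>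
  at \<open>x\<close>, and so have entropy \<open>-\<infinity>\<close>, for all \<open>x\<close> in a measurable set of positive measure. This way
  no measurability of the entropy of \<open>\<kappa> x\<close> in \<open>x\<close> is needed.\<close>
lemma absolutely_continuous_plan: "absolutely_continuous \<nu> \<pi>"
  unfolding absolutely_continuous_def
proof
  fix N assume "N \<in> null_sets \<nu>"
  then have N[measurable]: "N \<in> sets \<nu>" and "emeasure \<nu> N = 0" by auto
  then have "(\<integral>\<^sup>+ x. emeasure lborel (Pair x -` N) \<partial>P) = 0"
    by (simp add: lborel.emeasure_pair_measure_alt)
  then have null: "AE x in P. emeasure lborel (Pair x -` N) = 0"
    by (subst (asm) nn_integral_0_iff_AE) (auto intro: lborel.measurable_emeasure_Pair)
  have [measurable]: "(\<lambda>x. emeasure (\<kappa> x) (Pair x -` N)) \<in> borel_measurable P"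
  proof (rule emeasure_measurable_subprob_algebra2[OF _ measurable_prob_algebraD[OF kernel_measurable]])
    have "(SIGMA x:space P. Pair x -` N) = N"
      using sets.sets_into_space[OF N] by (auto simp: space_pair_measure)
    then show "(SIGMA x:space P. Pair x -` N) \<in> sets \<nu>" using N by metis
  qed
  \<comment> \<open>The factor \<open>top\<close> sends positive mass to infinity and mass 0 to 0.
    So the integrand is dominated pointwise by the negative part of the entropy, and a finite
    integral forces \<open>\<pi>\<close> to vanish on \<open>N\<close>.\<close>
  have "top * emeasure \<pi> N = (\<integral>\<^sup>+ x. top * emeasure (\<kappa> x) (Pair x -` N) \<partial>P)"
    unfolding emeasure_\<pi>[OF N] by (rule nn_integral_cmult[symmetric]) measurable
  also have "\<dots> \<le> (\<integral>\<^sup>+ x. e2ennreal (- diff_entropy (\<kappa> x)) \<partial>P)"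
  proof (rule nn_integral_mono_AE, use null in eventually_elim)
    case (elim x)
    show ?case
    proof (cases "emeasure (\<kappa> x) (Pair x -` N) = 0")
      case False
      have "Pair x -` N \<in> sets lborel"
        using N by (rule sets_Pair1)
      then have "Pair x -` N \<in> null_sets lborel"
        using elim by auto
      then have "\<not> absolutely_continuous lborel (\<kappa> x)"
        using False by (auto simp: absolutely_continuous_def)
      then show ?thesis
        by (simp add: diff_entropy_def)
    qed simp
  qed
  finally have "top * emeasure \<pi> N < top"
    using nn_integral_entropy_neg_part by (rule order_le_less_trans)
  then have "emeasure \<pi> N = 0"
    by (auto simp: ennreal_top_mult split: if_splits)
  then show "N \<in> null_sets \<pi>"
    using N unfolding sets_\<pi>[symmetric] by (intro null_setsI)
qed

text \<open>Tonelli would suffice were it not for cancellation inside a fibre: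
  \<open>ereal_integral\<close> splits the entropy into parts after integrating over
  \<open>y\<close>, whereas integrability under \<open>\<pi>\<close> splits \<open>ln g\<close>
  before. The functions \<open>a\<close> and \<open>b\<close> are the fibre integrals of the two
  parts, and their truncated differences are the parts of the entropy.\<close>

lemma entropy_eq_integral:
  assumes g[measurable]: "g \<in> borel_measurable \<nu>" and g_nn: "\<And>z. 0 \<le> g z"
    and \<pi>: "\<pi> = density \<nu> (\<lambda>z. ennreal (g z))"
  shows "integrable \<pi> (\<lambda>z. ln (g z))"
    and "ereal_integral P (\<lambda>x. diff_entropy (\<kappa> x)) = ereal (- (\<integral>z. ln (g z) \<partial>\<pi>))"
proof -
  define a where "a x = (\<integral>\<^sup>+ y. ennreal (g (x, y)) * ennreal (- ln (g (x, y))) \<partial>lborel)" for x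
  define b where "b x = (\<integral>\<^sup>+ y. ennreal (g (x, y)) * ennreal (ln (g (x, y))) \<partial>lborel)" for x
  have [measurable]: "a \<in> borel_measurable P" "b \<in> borel_measurable P"
    unfolding a_def[abs_def] b_def[abs_def] by measurable
  have a_int: "(\<integral>\<^sup>+ z. ennreal (- ln (g z)) \<partial>\<pi>) = (\<integral>\<^sup>+ x. a x \<partial>P)"
    unfolding \<pi> a_def by (subst nn_integral_density) (auto simp: lborel.nn_integral_fst[symmetric])
  have b_int: "(\<integral>\<^sup>+ z. ennreal (ln (g z)) \<partial>\<pi>) = (\<integral>\<^sup>+ x. b x \<partial>P)"
    unfolding \<pi> b_def by (subst nn_integral_density) (auto simp: lborel.nn_integral_fst[symmetric])
  have a_fin: "(\<integral>\<^sup>+ x. a x \<partial>P) < top"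
  proof -
    have "(\<integral>\<^sup>+ z. ennreal (- ln (g z)) \<partial>\<pi>) \<le> emeasure \<nu> (space P \<times> Y)"
      unfolding \<pi>
    proof (rule nn_integral_neg_ln_density_le)
      have "AE z in \<pi>. z \<in> space P \<times> Y"
        using AE_\<pi>_Y AE_space by eventually_elim (auto simp: space_\<pi> space_pair_measure)
      then show "AE z in density \<nu> (\<lambda>z. ennreal (g z)). z \<in> space P \<times> Y"
        unfolding \<pi> .
    qed (use g_nn in auto)
    also have "\<dots> < top"
      using Y_fin by (simp add: lborel.emeasure_pair_measure_Times emeasure_space_1)
    finally show ?thesis by (simp add: a_int)
  qed
  have "AE x in P. a x \<noteq> \<infinity>"
    using a_fin by (intro nn_integral_PInf_AE) auto
  moreover have "AE x in P. \<kappa> x = density lborel (\<lambda>y. ennreal (g (x, y)))"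
    by (rule cond_kernel_density[OF prob_space_axioms kernel _ \<pi>]) simp
  \<comment> \<open>Finiteness of \<open>a x\<close> is what allows the difference to be negated, as
    \<open>\<infinity> - \<infinity>\<close> would break it. Applying \<open>e2ennreal\<close> then
    gives the truncated subtraction of \<open>ennreal\<close>.\<close>
  ultimately have H: "AE x in P. e2ennreal (diff_entropy (\<kappa> x)) = a x - b x \<and>
      e2ennreal (- diff_entropy (\<kappa> x)) = b x - a x \<and> a x < top"
    using AE_space
  proof eventually_elim
    case (elim x)
    note x[measurable] = elim(3)
    have m: "(\<lambda>y. g (x, y)) \<in> borel_measurable lborel" by measurable
    have "diff_entropy (\<kappa> x) = ereal_integral (\<kappa> x) (\<lambda>y. ereal (- ln (g (x, y))))"
      by (rule diff_entropy_density[OF m g_nn elim(2)])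
    also have "\<dots> = enn2ereal (a x) - enn2ereal (b x)"
      unfolding ereal_integral_def elim(2) a_def b_def
      by (simp add: nn_integral_density)
    finally have D: "diff_entropy (\<kappa> x) = enn2ereal (a x) - enn2ereal (b x)" .
    have "- diff_entropy (\<kappa> x) = enn2ereal (b x) - enn2ereal (a x)"
      unfolding D using elim(1) by (cases "a x"; cases "b x") auto
    then show ?case
      using D elim(1) by (simp add: less_top)
  qed
  have H1: "(\<integral>\<^sup>+ x. e2ennreal (diff_entropy (\<kappa> x)) \<partial>P) = (\<integral>\<^sup>+ x. a x - b x \<partial>P)"
    by (rule nn_integral_cong_AE, use H in eventually_elim) simp
  have H2: "(\<integral>\<^sup>+ x. e2ennreal (- diff_entropy (\<kappa> x)) \<partial>P) = (\<integral>\<^sup>+ x. b x - a x \<partial>P)"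
    by (rule nn_integral_cong_AE, use H in eventually_elim) simp
  \<comment> \<open>Pointwise both sides are the maximum of \<open>a x\<close> and
    \<open>b x\<close>. Stated with sums, the relation can be integrated before \<open>b\<close> is
    known to have a finite integral, and it then yields that finiteness.\<close>
  have ab: "(\<integral>\<^sup>+ x. a x - b x \<partial>P) + (\<integral>\<^sup>+ x. b x \<partial>P) = (\<integral>\<^sup>+ x. b x - a x \<partial>P) + (\<integral>\<^sup>+ x. a x \<partial>P)"
  proof -
    have "(a x - b x) + b x = (b x - a x) + a x" for x
      by (cases "a x \<le> b x") (auto simp: diff_add_self_ennreal diff_eq_0_ennreal not_le less_imp_le ennreal_minus_eq_0)
    then show ?thesis
      by (subst (1 2) nn_integral_add[symmetric]) auto
  qed
  have p_fin: "(\<integral>\<^sup>+ x. a x - b x \<partial>P) < top"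
    using nn_integral_entropy_pos_part Y_fin unfolding H1 by (rule order_le_less_trans)
  have n_fin: "(\<integral>\<^sup>+ x. b x - a x \<partial>P) < top"
    using nn_integral_entropy_neg_part unfolding H2 .
  have b_fin: "(\<integral>\<^sup>+ x. b x \<partial>P) < top"
  proof -
    have "(\<integral>\<^sup>+ x. b x \<partial>P) \<le> (\<integral>\<^sup>+ x. b x - a x \<partial>P) + (\<integral>\<^sup>+ x. a x \<partial>P)"
      unfolding ab[symmetric] by simp
    also have "\<dots> < top"
      using n_fin a_fin by simp
    finally show ?thesis .
  qed
  show int: "integrable \<pi> (\<lambda>z. ln (g z))"
    using a_fin b_fin by (simp add: real_integrable_def a_int b_int less_top)
  have "- (\<integral>z. ln (g z) \<partial>\<pi>) = enn2real (\<integral>\<^sup>+ x. a x \<partial>P) - enn2real (\<integral>\<^sup>+ x. b x \<partial>P)"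
    by (simp add: real_lebesgue_integral_def[OF int] a_int b_int)
  then show "ereal_integral P (\<lambda>x. diff_entropy (\<kappa> x)) = ereal (- (\<integral>z. ln (g z) \<partial>\<pi>))"
    unfolding ereal_integral_def H1 H2 using ab p_fin n_fin a_fin b_fin
    by (cases "\<integral>\<^sup>+ x. a x \<partial>P"; cases "\<integral>\<^sup>+ x. b x \<partial>P"; cases "\<integral>\<^sup>+ x. a x - b x \<partial>P"; cases "\<integral>\<^sup>+ x. b x - a x \<partial>P")
      (auto simp flip: ennreal_plus)
qed

text \<open>Apart from the cost, \<open>log_dens\<close> is a function of \<open>y\<close> plus a
  function of \<open>x\<close>, so these terms see only the marginals of \<open>\<pi>\<close>. All
  terms are bounded, hence integrable.\<close>

lemma integral_log_dens:
  shows "integrable \<pi> log_dens"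
    and "\<epsilon> * (\<integral>z. log_dens z \<partial>\<pi>) = (\<integral>y. f y \<partial>Q) - (\<integral>z. c z \<partial>\<pi>) + (\<integral>x. ctrans c Y \<epsilon> f x \<partial>P)"
proof -
  interpret \<pi>: prob_space \<pi> by (rule prob_space_\<pi>)
  obtain B where B: "\<And>x. x \<in> space P \<Longrightarrow> \<bar>ln (Z x)\<bar> \<le> B"
    using ln_Z_bounded by blast
  have i1: "integrable \<pi> (\<lambda>z. f (snd z))"
    by (rule \<pi>.integrable_const_bound[of _ F]) (auto simp: f_bd)
  have i2: "integrable \<pi> c"
    by (rule \<pi>.integrable_const_bound[of _ C]) (auto simp: c_bd)
  have i3: "integrable \<pi> (\<lambda>z. ln (Z (fst z)))"
    by (rule \<pi>.integrable_const_bound[of _ B]) (auto simp: space_\<pi> space_pair_measure intro!: AE_I2 B)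
  show "integrable \<pi> log_dens"
    unfolding log_dens_def[abs_def] using i1 i2 i3 by simp
  have "(\<integral>y. f y \<partial>Q) = (\<integral>z. f (snd z) \<partial>\<pi>)"
    unfolding distr_snd[symmetric] by (rule integral_distr) auto
  moreover have "(\<integral>x. ln (Z x) \<partial>P) = (\<integral>z. ln (Z (fst z)) \<partial>\<pi>)"
    by (subst distr_fst[symmetric], rule integral_distr) auto
  ultimately show "\<epsilon> * (\<integral>z. log_dens z \<partial>\<pi>) = (\<integral>y. f y \<partial>Q) - (\<integral>z. c z \<partial>\<pi>) + (\<integral>x. ctrans c Y \<epsilon> f x \<partial>P)"
    unfolding log_dens_def ctrans_def using i1 i2 i3 eps by (simp add: field_simps)
qed

lemma KL_plan:
  "ereal \<epsilon> * KL \<pi> (pi_f c Y \<epsilon> P f) =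
     ereal (\<integral>z. c z \<partial>\<pi>) - ereal \<epsilon> * ereal_integral P (\<lambda>x. diff_entropy (\<kappa> x))
       - ereal (\<integral>y. f y \<partial>Q) - ereal (\<integral>x. ctrans c Y \<epsilon> f x \<partial>P)"
proof -
  interpret \<pi>: prob_space \<pi> by (rule prob_space_\<pi>)
  interpret pf: prob_space "pi_f c Y \<epsilon> P f" by (rule prob_space_pi_f)
  interpret pair_sigma_finite P "lborel :: 'y measure" by (rule pair_sigma_finite_P)
  obtain g where g[measurable]: "g \<in> borel_measurable \<nu>" and g_nn: "\<And>z. 0 \<le> g z"
    and \<pi>: "\<pi> = density \<nu> (\<lambda>z. ennreal (g z))" and g_pos: "AE z in \<pi>. 0 < g z"
    using obtain_real_density[OF P.sigma_finite_measure_axioms \<pi>.finite_measure_axioms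
      absolutely_continuous_plan sets_\<pi>] by blast
  note ent = entropy_eq_integral[OF g g_nn \<pi>]
  have "AE z in density \<nu> (\<lambda>z. ennreal (g z)). snd z \<in> Y"
    using AE_\<pi>_Y unfolding \<pi> .
  then have gY: "AE z in \<nu>. 0 < g z \<longrightarrow> snd z \<in> Y"
    by (simp add: AE_density)
  \<comment> \<open>The quotient of the densities of \<open>\<pi>\<close> and of the Gibbs plan. Off
    \<open>Y\<close> the latter vanishes, and by \<open>gY\<close> so does \<open>g\<close> almost
    everywhere.\<close>
  define p where "p z = indicator Y (snd z) * g z * exp (- log_dens z)" for z
  have "KL \<pi> (pi_f c Y \<epsilon> P f) = ereal_integral \<pi> (\<lambda>z. ereal (ln (p z)))"
  proof (rule KL_eq_ereal_integral[OF pf.sigma_finite_measure_axioms])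
    have "density (pi_f c Y \<epsilon> P f) (\<lambda>z. ennreal (p z))
        = density \<nu> (\<lambda>z. ennreal (indicator Y (snd z) * exp (log_dens z)) * ennreal (p z))"
      unfolding pi_f_eq p_def by (rule density_density_eq) measurable
    also have "\<dots> = \<pi>"
      unfolding \<pi>
    proof (rule density_cong)
      show "AE z in \<nu>. ennreal (indicator Y (snd z) * exp (log_dens z)) * ennreal (p z) = ennreal (g z)"
        using gY
      proof eventually_elim
        case (elim z)
        show ?case
          using elim g_nn[of z]
          by (cases "g z = 0") (auto simp: p_def exp_minus simp flip: ennreal_mult')
      qed
    qed (auto simp: p_def)
    finally show "\<pi> = density (pi_f c Y \<epsilon> P f) (\<lambda>z. ennreal (p z))" ..
  qed (auto simp: p_def[abs_def] g_nn pi_f_def)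
  also have "\<dots> = ereal_integral \<pi> (\<lambda>z. ereal (ln (g z) - log_dens z))"
    by (rule ereal_integral_cong_AE, use AE_\<pi>_Y g_pos in eventually_elim)
      (simp add: p_def ln_mult)
  \<comment> \<open>Both logarithms are integrable, so the integral splits into real numbers: the
    first is minus the averaged entropy, the second is given by
    \<open>integral_log_dens\<close>.\<close>
  also have "\<dots> = ereal ((\<integral>z. ln (g z) \<partial>\<pi>) - (\<integral>z. log_dens z \<partial>\<pi>))"
    using ent(1) integral_log_dens(1) by (simp add: ereal_integral_integrable)
  finally show ?thesis
    using integral_log_dens(2) unfolding ent(2) by (simp add: right_diff_distrib)
qed

end

lemma KL_marginal_le: "KL Q (Q_f c Y \<epsilon> P f) \<le> KL \<pi> (pi_f c Y \<epsilon> P f)"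
  unfolding Q_f_def distr_snd[symmetric]
  by (rule KL_distr_le[OF prob_space_pi_f prob_space_\<pi>]) (simp add: pi_f_def)

end

section \<open>From continuous data on compact sets to the bounded setting\<close>

text \<open>Continuity refers to the product topology on all of
  \<open>nat \<Rightarrow> real\<close>, while \<open>P\<close> lives on the product sigma-algebra
  over the first \<open>n\<close> coordinates. The two are linked by measurability of the identity,
  checked coordinatewise.\<close>

lemma borel_measurable_indicator_cost:
  fixes c :: "(nat \<Rightarrow> real) \<times> 'y::euclidean_space \<Rightarrow> real"
  assumes "compact X" "compact Y" "continuous_on (X \<times> Y) c" and P: "sets P = sets (lebR n)"
  shows "(\<lambda>z. indicator (X \<times> Y) z * c z) \<in> borel_measurable (P \<Otimes>\<^sub>M lborel)"
proof -
  have space: "space P = {..<n} \<rightarrow>\<^sub>E UNIV"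
    using sets_eq_imp_space_eq[OF P] by (simp add: lebR_def space_PiM)
  have id: "(\<lambda>x. x) \<in> P \<rightarrow>\<^sub>M (borel :: (nat \<Rightarrow> real) measure)"
  proof (rule measurable_coordinatewise_then_product)
    fix i :: nat
    show "(\<lambda>x. x i) \<in> borel_measurable P"
    proof (cases "i < n")
      case True
      then have "(\<lambda>x. x i) \<in> lebR n \<rightarrow>\<^sub>M lborel"
        unfolding lebR_def by (intro measurable_component_singleton) simp
      then show ?thesis
        using measurable_cong_sets[OF P, of "borel :: real measure" borel] by simp
    next
      \<comment> \<open>Points of \<open>space P\<close> are extensional functions, so these
        coordinates are constantly \<open>undefined\<close>.\<close>
      case False
      then show ?thesis
        by (subst measurable_cong[where g="\<lambda>_. undefined"]) (auto simp: space PiE_def extensional_def)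
    qed
  qed
  have "(\<lambda>z. (fst z, snd z)) \<in> P \<Otimes>\<^sub>M lborel \<rightarrow>\<^sub>M (borel :: (nat \<Rightarrow> real) measure) \<Otimes>\<^sub>M (borel :: 'y measure)"
    using measurable_compose[OF measurable_fst id] by (intro measurable_Pair) auto
  then have emb: "(\<lambda>z. z) \<in> P \<Otimes>\<^sub>M lborel \<rightarrow>\<^sub>M (borel :: ((nat \<Rightarrow> real) \<times> 'y) measure)"
    by (simp add: borel_prod)
  have "closed (X \<times> Y)"
    using assms by (intro compact_imp_closed compact_Times)
  then have "(\<lambda>z. indicator (X \<times> Y) z *\<^sub>R c z) \<in> borel_measurable borel"
    using assms(3) by (intro borel_measurable_continuous_on_indicator) auto
  from measurable_compose[OF emb this] show ?thesis
    by simp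
qed

lemma compact_indicator_bounded:
  fixes c :: "'a::topological_space \<Rightarrow> real"
  assumes "compact S" "continuous_on S c"
  obtains C where "\<And>z. \<bar>indicator S z * c z\<bar> \<le> C"
proof -
  have "bounded (c ` S)"
    using compact_continuous_image[OF assms(2,1)] by (rule compact_imp_bounded)
  then obtain C where C: "\<And>z. z \<in> S \<Longrightarrow> \<bar>c z\<bar> \<le> C"
    by (auto simp: bounded_iff)
  show thesis
  proof (rule that)
    fix z show "\<bar>indicator S z * c z\<bar> \<le> max 0 C"
      using C[of z] by (auto split: split_indicator)
  qed
qed

text \<open>The extensions by 0, \<open>c'\<close> and \<open>f'\<close>, fit the locale, and each
  quantity is unchanged because the integrals are restricted to \<open>X\<close>, \<open>Y\<close>
  or their product and \<open>P\<close> is carried by \<open>X\<close>. Integrability of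
  \<open>f\<close> is recorded for summing over several potentials later.\<close>

lemma EOT_duality_gap:
  fixes c :: "(nat \<Rightarrow> real) \<times> 'y::euclidean_space \<Rightarrow> real"
  assumes X: "compact X" and Y: "compact Y" "0 < emeasure lborel Y"
    and P: "prob_space P" "sets P = sets (lebR n)" "emeasure P X = 1"
    and c: "continuous_on (X \<times> Y) c" and f: "continuous_on Y f" and eps: "0 < \<epsilon>"
    and Q: "Q \<in> probs_on Y" and \<pi>: "coupling P Q \<pi>" "cond_kernel P \<pi> \<kappa>"
  shows "EOT_obj c (X \<times> Y) \<epsilon> P \<pi> \<kappa> \<noteq> -\<infinity>"
    and "EOT_obj c (X \<times> Y) \<epsilon> P \<pi> \<kappa> \<noteq> \<infinity> \<Longrightarrow>
      ereal \<epsilon> * KL \<pi> (pi_f c Y \<epsilon> P f) =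
        EOT_obj c (X \<times> Y) \<epsilon> P \<pi> \<kappa> - ereal (LINT y:Y|Q. f y) - ereal (LINT x:X|P. ctrans c Y \<epsilon> f x)"
    and "KL Q (Q_f c Y \<epsilon> P f) \<le> KL \<pi> (pi_f c Y \<epsilon> P f)"
    and "set_integrable Q Y f"
proof -
  interpret P: prob_space P by fact
  interpret Q: prob_space Q using Q by (simp add: probs_on_def)
  have sets_Q[measurable_cong]: "sets Q = sets borel"
    using Q by (simp add: probs_on_def)
  define c' where "c' z = indicator (X \<times> Y) z * c z" for z
  define f' where "f' y = indicator Y y * f y" for y
  obtain C where C: "\<And>z. \<bar>c' z\<bar> \<le> C"
    using compact_indicator_bounded[OF compact_Times[OF X Y(1)] c] unfolding c'_def by blast
  obtain F where F: "\<And>y. \<bar>f' y\<bar> \<le> F"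
    using compact_indicator_bounded[OF Y(1) f] unfolding f'_def by blast
  \<comment> \<open>Sets outside the sigma-algebra get \<open>emeasure\<close> 0, so mass 1 entails
    measurability.\<close>
  have XP[measurable]: "X \<in> sets P"
    using P(3) emeasure_notin_sets[of X P] by fastforce
  have Yb[measurable]: "Y \<in> sets borel"
    using Y(1) by (simp add: borel_compact)
  have f'[measurable]: "f' \<in> borel_measurable borel"
    using borel_measurable_continuous_on_indicator[OF Yb f] by (simp add: f'_def[abs_def])
  interpret bounded_cost_plan P Y c' f' \<epsilon> C F Q \<pi> \<kappa>
  proof
    show "emeasure lborel Y < top"
      using emeasure_compact_finite[OF Y(1)] by simp
    show "c' \<in> borel_measurable (P \<Otimes>\<^sub>M lborel)"
      unfolding c'_def by (rule borel_measurable_indicator_cost[OF X Y(1) c P(2)])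
  qed (use Y C F Yb f' eps Q \<pi> in auto)
  have "emeasure P (space P - X) = 0"
    using P(3) by (subst emeasure_compl) (auto simp: P.emeasure_space_1)
  then have pi_f: "pi_f c Y \<epsilon> P f = pi_f c' Y \<epsilon> P f'"
    by (intro pi_f_cong[OF XP]) (auto simp: c'_def f'_def)
  have cost: "(LINT z:X \<times> Y|\<pi>. c z) = (\<integral>z. c' z \<partial>\<pi>)"
    by (simp add: set_lebesgue_integral_def c'_def)
  have pot: "(LINT y:Y|Q. f y) = (\<integral>y. f' y \<partial>Q)"
    by (simp add: set_lebesgue_integral_def f'_def)
  have "ctrans c Y \<epsilon> f x = ctrans c' Y \<epsilon> f' x" if "x \<in> X" for x
    unfolding ctrans_def Zc_def set_lebesgue_integral_def c'_def f'_def using that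
    by (intro arg_cong2[where f="(*)"] arg_cong[where f=ln] refl Bochner_Integration.integral_cong)
      (auto split: split_indicator)
  then have "(LINT x:X|P. ctrans c Y \<epsilon> f x) = (LINT x:X|P. ctrans c' Y \<epsilon> f' x)"
    by (intro set_lebesgue_integral_cong) auto
  also have "\<dots> = (\<integral>x. ctrans c' Y \<epsilon> f' x \<partial>P)"
  proof -
    have "AE x in P. x \<in> X"
      using P(3) by (intro P.AE_prob_1) (simp add: P.emeasure_eq_measure)
    then have "AE x in P. indicator X x *\<^sub>R ctrans c' Y \<epsilon> f' x = ctrans c' Y \<epsilon> f' x"
      by eventually_elim simp
    moreover have "ctrans c' Y \<epsilon> f' \<in> borel_measurable P"
      unfolding ctrans_def[abs_def] by measurable
    ultimately show ?thesis
      unfolding set_lebesgue_integral_def by (intro integral_cong_AE) auto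
  qed
  finally have ct: "(LINT x:X|P. ctrans c Y \<epsilon> f x) = (\<integral>x. ctrans c' Y \<epsilon> f' x \<partial>P)" .
  let ?H = "ereal_integral P (\<lambda>x. diff_entropy (\<kappa> x))"
  show "EOT_obj c (X \<times> Y) \<epsilon> P \<pi> \<kappa> \<noteq> -\<infinity>"
    unfolding EOT_obj_def using entropy_lt_PInf eps by (cases ?H) auto
  show "ereal \<epsilon> * KL \<pi> (pi_f c Y \<epsilon> P f) =
        EOT_obj c (X \<times> Y) \<epsilon> P \<pi> \<kappa> - ereal (LINT y:Y|Q. f y) - ereal (LINT x:X|P. ctrans c Y \<epsilon> f x)"
    if "EOT_obj c (X \<times> Y) \<epsilon> P \<pi> \<kappa> \<noteq> \<infinity>"
  proof -
    have "?H \<noteq> -\<infinity>"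
      using that eps by (auto simp: EOT_obj_def)
    then show ?thesis
      unfolding EOT_obj_def cost pot ct pi_f by (rule KL_plan)
  qed
  show "KL Q (Q_f c Y \<epsilon> P f) \<le> KL \<pi> (pi_f c Y \<epsilon> P f)"
    using KL_marginal_le by (simp add: Q_f_def pi_f)
  show "set_integrable Q Y f"
    unfolding set_integrable_def
    by (rule Q.integrable_const_bound[of _ F]) (use F in \<open>auto simp flip: f'_def\<close>)
qed

section \<open>Averaging over the marginals at the barycenter\<close>

theorem theorem2:
  fixes K :: nat and D :: "nat \<Rightarrow> nat"
    and X :: "nat \<Rightarrow> (nat \<Rightarrow> real) set" and P :: "nat \<Rightarrow> (nat \<Rightarrow> real) measure"
    and Y :: "'y::euclidean_space set"
    and c :: "nat \<Rightarrow> (nat \<Rightarrow> real) \<times> 'y \<Rightarrow> real"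
    and w :: "nat \<Rightarrow> real" and \<epsilon> :: real
    and Qs :: "'y measure" and \<pi>s :: "nat \<Rightarrow> ((nat \<Rightarrow> real) \<times> 'y) measure"
    and f :: "nat \<Rightarrow> 'y \<Rightarrow> real"
  assumes K: "K \<ge> 1"
    and X: "\<And>k. k \<in> {1..K} \<Longrightarrow> 0 < D k \<and> compact (X k) \<and> X k \<subseteq> {..<D k} \<rightarrow>\<^sub>E UNIV"
    and Y: "compact Y" "emeasure lborel Y > 0"
    and P: "\<And>k. k \<in> {1..K} \<Longrightarrow> prob_space (P k) \<and> sets (P k) = sets (lebR (D k)) \<and>
              emeasure (P k) (X k) = 1 \<and> absolutely_continuous (lebR (D k)) (P k)"
    and c: "\<And>k. k \<in> {1..K} \<Longrightarrow> continuous_on (X k \<times> Y) (c k)"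
    and w: "\<And>k. k \<in> {1..K} \<Longrightarrow> w k > 0" "(\<Sum>k\<in>{1..K}. w k) = 1"
    and eps: "\<epsilon> > 0"
    and finite: "\<exists>Q \<in> probs_on Y. \<bar>\<Sum>k\<in>{1..K}. ereal (w k) * EOT (c k) (X k \<times> Y) \<epsilon> (P k) Q\<bar> \<noteq> \<infinity>"
    and Qs: "Qs \<in> probs_on Y"
      "(\<Sum>k\<in>{1..K}. ereal (w k) * EOT (c k) (X k \<times> Y) \<epsilon> (P k) Qs) =
       (INF Q \<in> probs_on Y. \<Sum>k\<in>{1..K}. ereal (w k) * EOT (c k) (X k \<times> Y) \<epsilon> (P k) Q)"
    and \<pi>s: "\<And>k. k \<in> {1..K} \<Longrightarrow> EOT_minimizer (c k) (X k \<times> Y) \<epsilon> (P k) Qs (\<pi>s k)"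
    and f: "\<And>k. k \<in> {1..K} \<Longrightarrow> continuous_on Y (f k)"
    and congruent: "\<And>y. y \<in> Y \<Longrightarrow> (\<Sum>k\<in>{1..K}. w k * f k y) = 0"
  shows "(INF Q \<in> probs_on Y. \<Sum>k\<in>{1..K}. ereal (w k) * EOT (c k) (X k \<times> Y) \<epsilon> (P k) Q)
           - ereal (\<Sum>k\<in>{1..K}. w k * (LINT x:X k|P k. ctrans (c k) Y \<epsilon> (f k) x))
         = ereal \<epsilon> * (\<Sum>k\<in>{1..K}. ereal (w k) * KL (\<pi>s k) (pi_f (c k) Y \<epsilon> (P k) (f k)))
       \<and> ereal \<epsilon> * (\<Sum>k\<in>{1..K}. ereal (w k) * KL (\<pi>s k) (pi_f (c k) Y \<epsilon> (P k) (f k)))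
         \<ge> ereal \<epsilon> * (\<Sum>k\<in>{1..K}. ereal (w k) * KL Qs (Q_f (c k) Y \<epsilon> (P k) (f k)))"
proof -
  define E where "E k = EOT (c k) (X k \<times> Y) \<epsilon> (P k) Qs" for k
  define KLp where "KLp k = KL (\<pi>s k) (pi_f (c k) Y \<epsilon> (P k) (f k))" for k
  define KLq where "KLq k = KL Qs (Q_f (c k) Y \<epsilon> (P k) (f k))" for k
  define G where "G k = (LINT y:Y|Qs. f k y)" for k
  define T where "T k = (LINT x:X k|P k. ctrans (c k) Y \<epsilon> (f k) x)" for k
  let ?L = "INF Q \<in> probs_on Y. \<Sum>k\<in>{1..K}. ereal (w k) * EOT (c k) (X k \<times> Y) \<epsilon> (P k) Q"
  have gap: "E k \<noteq> -\<infinity> \<and> (E k \<noteq> \<infinity> \<longrightarrow> ereal \<epsilon> * KLp k = E k - ereal (G k) - ereal (T k)) \<and>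
      KLq k \<le> KLp k \<and> set_integrable Qs Y (f k)" if k: "k \<in> {1..K}" for k
  proof -
    obtain \<kappa> where \<kappa>: "coupling (P k) Qs (\<pi>s k)" "cond_kernel (P k) (\<pi>s k) \<kappa>"
      and E: "E k = EOT_obj (c k) (X k \<times> Y) \<epsilon> (P k) (\<pi>s k) \<kappa>"
      using \<pi>s[OF k] by (auto simp: EOT_minimizer_def E_def)
    have Xk: "compact (X k)"
      and Pk: "prob_space (P k)" "sets (P k) = sets (lebR (D k))" "emeasure (P k) (X k) = 1"
      using X[OF k] P[OF k] by auto
    note g = EOT_duality_gap[OF Xk Y Pk c[OF k] f[OF k] eps Qs(1) \<kappa>]
    show ?thesis
      unfolding E KLp_def KLq_def G_def T_def using g by blast
  qed
  have L: "?L = (\<Sum>k\<in>{1..K}. ereal (w k) * E k)"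
    unfolding E_def by (rule Qs(2)[symmetric])
  \<comment> \<open>Finiteness is assumed at some \<open>Q\<close>, possibly not \<open>Qs\<close>;
    it reaches \<open>Qs\<close> through the infimum.\<close>
  have "?L < \<infinity>"
  proof -
    from finite obtain Q where Q: "Q \<in> probs_on Y"
      "\<bar>\<Sum>k\<in>{1..K}. ereal (w k) * EOT (c k) (X k \<times> Y) \<epsilon> (P k) Q\<bar> \<noteq> \<infinity>" ..
    have "?L \<le> (\<Sum>k\<in>{1..K}. ereal (w k) * EOT (c k) (X k \<times> Y) \<epsilon> (P k) Q)"
      by (rule INF_lower[OF Q(1)])
    also have "\<dots> < \<infinity>"
      using Q(2) by auto
    finally show ?thesis .
  qed
  \<comment> \<open>A finite sum in \<open>ereal\<close> is \<open>\<infinity>\<close> as soon as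
    one summand is, so every summand avoids this value. The value \<open>-\<infinity>\<close> is
    excluded by \<open>gap\<close>, so real arithmetic applies from here on.\<close>
  have E_fin: "\<bar>E k\<bar> \<noteq> \<infinity>" if k: "k \<in> {1..K}" for k
  proof -
    have "ereal (w k) * E k \<noteq> \<infinity>"
      using \<open>?L < \<infinity>\<close> k unfolding L by (auto simp: sum_Pinfty)
    then show ?thesis
      using gap[OF k] w(1)[OF k] by auto
  qed
  define e where "e k = real_of_ereal (E k)" for k
  \<comment> \<open>The real value that the gap identity forces on \<open>KLp k\<close> after
    division by \<open>\<epsilon>\<close>.\<close>
  define l where "l k = (e k - G k - T k) / \<epsilon>" for k
  have E: "E k = ereal (e k)" if "k \<in> {1..K}" for k
    using E_fin[OF that] by (simp add: e_def ereal_real)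
  have KLp: "KLp k = ereal (l k)" if "k \<in> {1..K}" for k
  proof -
    have "ereal \<epsilon> * KLp k = ereal (e k - G k - T k)"
      using gap[OF that] E[OF that] by simp
    then show ?thesis
      using eps by (cases "KLp k") (auto simp: l_def field_simps)
  qed
  \<comment> \<open>All potentials are integrated against the same \<open>Qs\<close>, so the
    weighted sum moves inside. It vanishes on \<open>Y\<close> by congruence and elsewhere by the
    indicator.\<close>
  have "(\<Sum>k\<in>{1..K}. w k * G k) = (\<Sum>k\<in>{1..K}. \<integral>y. w k * (indicator Y y *\<^sub>R f k y) \<partial>Qs)"
    by (simp add: G_def set_lebesgue_integral_def)
  also have "\<dots> = (\<integral>y. (\<Sum>k\<in>{1..K}. w k * (indicator Y y *\<^sub>R f k y)) \<partial>Qs)"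
    using gap by (intro Bochner_Integration.integral_sum[symmetric] integrable_mult_right)
      (simp add: set_integrable_def)
  also have "\<dots> = (\<integral>y. 0 \<partial>Qs)"
    using congruent by (intro Bochner_Integration.integral_cong) (auto split: split_indicator)
  finally have G0: "(\<Sum>k\<in>{1..K}. w k * G k) = 0"
    by simp
  have "\<epsilon> * (\<Sum>k\<in>{1..K}. w k * l k) = (\<Sum>k\<in>{1..K}. w k * e k) - (\<Sum>k\<in>{1..K}. w k * G k) - (\<Sum>k\<in>{1..K}. w k * T k)"
    unfolding sum_distrib_left sum_subtractf[symmetric] l_def using eps
    by (intro sum.cong) (auto simp: field_simps)
  moreover have "?L = ereal (\<Sum>k\<in>{1..K}. w k * e k)"
    unfolding L sum_ereal[symmetric] by (rule sum.cong) (simp_all add: E)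
  moreover have "(\<Sum>k\<in>{1..K}. ereal (w k) * KLp k) = ereal (\<Sum>k\<in>{1..K}. w k * l k)"
    unfolding sum_ereal[symmetric] by (rule sum.cong) (simp_all add: KLp)
  ultimately have eq: "?L - ereal (\<Sum>k\<in>{1..K}. w k * T k) = ereal \<epsilon> * (\<Sum>k\<in>{1..K}. ereal (w k) * KLp k)"
    using G0 by simp
  have "(\<Sum>k\<in>{1..K}. ereal (w k) * KLq k) \<le> (\<Sum>k\<in>{1..K}. ereal (w k) * KLp k)"
    using gap w(1) by (intro sum_mono ereal_mult_left_mono) (auto simp: less_imp_le)
  then have "ereal \<epsilon> * (\<Sum>k\<in>{1..K}. ereal (w k) * KLq k) \<le> ereal \<epsilon> * (\<Sum>k\<in>{1..K}. ereal (w k) * KLp k)"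
    using eps by (intro ereal_mult_left_mono) auto
  with eq show ?thesis
    unfolding KLp_def KLq_def T_def by blast
qed

end
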